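(* Let $n\ge1$. Every codimension-one outer face $C_{n+1}^{x_j=\epsilon}$ ($0\le j\le n$, $\epsilon\in\{0,1\}$) of $C_{n+1}$, regarded as a formal $n$-cube with labels in $[n+1]$, is generated under gluing by the formal $n$-cubes $C_n^i$ and $D_n^i$, $0\le i\le n+1$.
   Context: $\mathrm{Sub}[m]$ is the set of nonempty subsets of $\{0,\dots,m\}$. A formal $n$-cube with labels in $[m]$ is a map $X\colon\{0,1\}^n\to\mathrm{Sub}[m]$. Points are written $x=(x_0,\dots,x_{n-1})$, with the convention $x_{-1}=1$, $x_n=0$. $X$ is determined by its label functions $f_0,\dots,f_m\colon\{0,1\}^n\to\{0,1\}$, $f_i(x)=1\iff i\in X(x)$. $C_n$ ($n\ge1$) is the formal $n$-cube with labels in $[n]$ and label functions $f_i=x_i\vee\neg x_{i-1}$ for $0\le i\le n$. $D_n$ has label functions $f_i=x_i\vee\neg x_{i-1}$ for $i<n$ and $f_n=1$. For $0\le i\le n+1$ let $\delta_i\colon[n]\to[n+1]$ be the increasing injection missing $i$; $C_n^i$ and $D_n^i$ are the formal $n$-cubes with labels in $[n+1]$ obtained from $C_n$, $D_n$ by replacing each label set by its image under $\delta_i$. For a formal $(n+1)$-cube $X$, the face $X^{x_j=\epsilon}$ is the formal $n$-cube $(x_0,\dots,x_{n-1})\mapsto X(x_0,\dots,x_{j-1},\epsilon,x_j,\dots,x_{n-1})$. Gluing: if formal $n$-cubes $A,B$ with labels in $[m]$ agree on the face $[x_j=\epsilon]$ ($0\le j<n$, $\epsilon\in\{0,1\}$),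 their gluing $AB$ is the formal $n$-cube whose value at $x$ is $A$ evaluated at $x$ with $x_j$ replaced by $1-\epsilon$ if $x_j=1$, and $B$ evaluated at $x$ with $x_j$ replaced by $1-\epsilon$ if $x_j=0$. "Generated under gluing" means lying in the smallest set of formal $n$-cubes containing the given ones and closed under all gluings. *)

theory Defs
  imports "HOL-Library.FuncSet"
begin

(* Points of {0,1}^n are boolean lists of length n, with True for 1 and False for 0; the
   coordinate x_j is x ! j. Formal cubes are extensional on the points, so that HOL equality
   is equality of maps on {0,1}^n. *)

definition points :: "nat \<Rightarrow> bool list set" where
  "points n = {x. length x = n}"

definition Sub :: "nat \<Rightarrow> nat set set" where
  "Sub m = Pow {0..m} - {{}}"

type_synonym cube = "bool list \<Rightarrow> nat set"

definition formal_cubes :: "nat \<Rightarrow> nat \<Rightarrow> cube set" where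
  "formal_cubes n m = points n \<rightarrow>\<^sub>E Sub m"

(* The convention x_{-1} = 1 and x_n = 0, where n is the length of x. *)
definition coord :: "bool list \<Rightarrow> int \<Rightarrow> bool" where
  "coord x i = (if i = -1 then True else if i = int (length x) then False else x ! nat i)"

definition cube_of_labels :: "nat \<Rightarrow> nat \<Rightarrow> (nat \<Rightarrow> bool list \<Rightarrow> bool) \<Rightarrow> cube" where
  "cube_of_labels n m f = (\<lambda>x\<in>points n. {i \<in> {0..m}. f i x})"

definition C_cube :: "nat \<Rightarrow> cube" where
  "C_cube n = cube_of_labels n n (\<lambda>i x. coord x (int i) \<or> \<not> coord x (int i - 1))"

definition D_cube :: "nat \<Rightarrow> cube" where
  "D_cube n = cube_of_labels n n
     (\<lambda>i x. if i < n then coord x (int i) \<or> \<not> coord x (int i - 1) else True)"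

definition delta :: "nat \<Rightarrow> nat \<Rightarrow> nat" where
  "delta i k = (if k < i then k else Suc k)"

definition relabel :: "nat \<Rightarrow> (nat \<Rightarrow> nat) \<Rightarrow> cube \<Rightarrow> cube" where
  "relabel n d X = (\<lambda>x\<in>points n. d ` X x)"

definition C_relabelled :: "nat \<Rightarrow> nat \<Rightarrow> cube" where
  "C_relabelled n i = relabel n (delta i) (C_cube n)"

definition D_relabelled :: "nat \<Rightarrow> nat \<Rightarrow> cube" where
  "D_relabelled n i = relabel n (delta i) (D_cube n)"

(* The first argument is the dimension of the face, so X is an (n+1)-cube. *)
definition face :: "nat \<Rightarrow> nat \<Rightarrow> bool \<Rightarrow> cube \<Rightarrow> cube" where
  "face n j e X = (\<lambda>x\<in>points n. X (take j x @ e # drop j x))"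

definition agree_on_face :: "nat \<Rightarrow> nat \<Rightarrow> bool \<Rightarrow> cube \<Rightarrow> cube \<Rightarrow> bool" where
  "agree_on_face n j e A B \<longleftrightarrow> face (n - 1) j e A = face (n - 1) j e B"

definition glue :: "nat \<Rightarrow> nat \<Rightarrow> bool \<Rightarrow> cube \<Rightarrow> cube \<Rightarrow> cube" where
  "glue n j e A B = (\<lambda>x\<in>points n. if x ! j then A (x[j := \<not> e]) else B (x[j := \<not> e]))"

inductive_set generated_by_gluing :: "nat \<Rightarrow> cube set \<Rightarrow> cube set" for n :: nat and S :: "cube set"
  where
    base: "A \<in> S \<Longrightarrow> A \<in> generated_by_gluing n S"
  | glue: "A \<in> generated_by_gluing n S \<Longrightarrow> B \<in> generated_by_gluing n S \<Longrightarrow> j < n \<Longrightarrow>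
           agree_on_face n j e A B \<Longrightarrow> glue n j e A B \<in> generated_by_gluing n S"

lemma glue_in_formal_cubes:
  assumes "A \<in> formal_cubes n m" "B \<in> formal_cubes n m"
  shows "glue n j e A B \<in> formal_cubes n m"
  using assms by (auto simp: glue_def formal_cubes_def points_def PiE_iff)

lemma generated_by_gluing_subset:
  assumes "S \<subseteq> formal_cubes n m"
  shows "generated_by_gluing n S \<subseteq> formal_cubes n m"
proof
  fix X assume "X \<in> generated_by_gluing n S"
  then show "X \<in> formal_cubes n m"
    by induction (use assms glue_in_formal_cubes in auto)
qed

lemma C_cube_nonempty:
  assumes "length x = n" "n \<ge> 1"
  shows "\<exists>i\<le>n. coord x (int i) \<or> \<not> coord x (int i - 1)"
proof (rule ccontr)
  assume "\<not> ?thesis"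
  then have *: "\<not> coord x (int i) \<and> coord x (int i - 1)" if "i \<le> n" for i
    using that by blast
  show False using *[of 0] *[of 1] assms by simp
qed

lemma C_cube_in_formal_cubes: "n \<ge> 1 \<Longrightarrow> C_cube n \<in> formal_cubes n n"
  using C_cube_nonempty
  by (fastforce simp: C_cube_def cube_of_labels_def formal_cubes_def points_def Sub_def)

lemma D_cube_in_formal_cubes: "D_cube n \<in> formal_cubes n n"
  by (auto simp: D_cube_def cube_of_labels_def formal_cubes_def points_def Sub_def)

lemma relabel_delta_in_formal_cubes:
  assumes "X \<in> formal_cubes n m"
  shows "relabel n (delta i) X \<in> formal_cubes n (Suc m)"
proof -
  have "delta i ` L \<in> Sub (Suc m)" if "L \<in> Sub m" for L
    using that by (fastforce simp: Sub_def delta_def)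
  then show ?thesis
    using assms by (auto simp: relabel_def formal_cubes_def PiE_iff)
qed

lemma face_in_formal_cubes:
  assumes "X \<in> formal_cubes (Suc n) m" "j \<le> n"
  shows "face n j e X \<in> formal_cubes n m"
  using assms by (auto simp: face_def formal_cubes_def points_def PiE_iff)

end

theory Submission
  imports Defs
begin

text \<open>
  Let \<open>W m i\<close> (\<open>omit_label\<close>) be \<open>C_n^i\<close> with the label function of \<open>m\<close> replaced by 1. Then
  \<open>D_n^i\<close> is the case where \<open>m\<close> is the last label other than \<open>i\<close>, and gluing \<open>W m i\<close> to
  \<open>C_n^i\<close> moves the constant label one place down, so every \<open>W m i\<close> is generated.
  Next let \<open>S m k\<close> (\<open>split_label\<close>) have the label functions \<open>x_i \<or> \<not> x_{i-1}\<close> for \<open>i < k\<close>, \<open>\<not> x_{k-1}\<close>, \<open>x_k\<close>,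
  then \<open>x_{i-1} \<or> \<not> x_{i-2}\<close> for \<open>i > k + 1\<close>, again with that of \<open>m\<close> replaced by 1.
  The face \<open>x_j = 1\<close> is \<open>S j j\<close> and the face \<open>x_j = 0\<close> is \<open>S (j + 1) j\<close>.
  Gluing with \<open>W m (k + 1)\<close> leads from \<open>S m (k + 1)\<close> down to \<open>S m k\<close> when \<open>m \<le> k\<close>, starting at
  \<open>S m n = W m (n + 1)\<close>; dually, gluing with \<open>W m k\<close> leads from \<open>S m (k - 1)\<close> up to \<open>S m k\<close> when
  \<open>m > k\<close>, starting at \<open>S m 0 = W m 0\<close>.
\<close>

text \<open>The shift makes the index of \<open>x_{-1}\<close> a natural number.\<close>
definition shifted :: "bool list \<Rightarrow> nat \<Rightarrow> bool" where
  "shifted x i = coord x (int i - 1)"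

lemma shifted_0: "shifted x 0"
  by (simp add: shifted_def coord_def)

lemma shifted_last: "length x = n \<Longrightarrow> \<not> shifted x (Suc n)"
  by (simp add: shifted_def coord_def)

lemma shifted_nth: "i < length x \<Longrightarrow> shifted x (Suc i) = x ! i"
  by (simp add: shifted_def coord_def)

lemma shifted_list_update:
  "j < length x \<Longrightarrow> shifted (x[j := b]) = (shifted x)(Suc j := b)"
  by (rule ext) (auto simp: shifted_def coord_def nth_list_update)

lemma shifted_insert:
  assumes "j \<le> length x" "l \<le> length x + 2"
  shows "shifted (take j x @ e # drop j x) l =
    (if l \<le> j then shifted x l else if l = Suc j then e else shifted x (l - 1))"
proof (cases l)
  case 0
  then show ?thesis by (simp add: shifted_0)
next
  case (Suc i)
  consider "i < j" | "i = j" | p where "i = Suc p" "j \<le> p" "p < length x" | "i = Suc (length x)"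
  proof -
    have "i < j \<or> i = j \<or> (j \<le> i - 1 \<and> i - 1 < length x \<and> i = Suc (i - 1)) \<or> i = Suc (length x)"
      using assms(2) Suc by linarith
    then show thesis using that by blast
  qed
  then show ?thesis
  proof cases
    case 1
    with Suc assms show ?thesis by (simp add: shifted_nth nth_append)
  next
    case 2
    with Suc assms show ?thesis by (simp add: shifted_nth nth_append)
  next
    case 3
    with Suc assms show ?thesis by (simp add: shifted_nth nth_append Suc_diff_le)
  next
    case 4
    with Suc assms show ?thesis by (simp add: shifted_last)
  qed
qed

definition edge_label :: "(nat \<Rightarrow> bool) \<Rightarrow> nat \<Rightarrow> bool" where
  "edge_label v i \<longleftrightarrow> v (Suc i) \<or> \<not> v i"

text \<open>Label functions act on sequences \<open>v\<close> instead of points, so that changing a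
  coordinate is a function update.\<close>

definition shifted_cube :: "nat \<Rightarrow> ((nat \<Rightarrow> bool) \<Rightarrow> nat \<Rightarrow> bool) \<Rightarrow> cube" where
  "shifted_cube n F = cube_of_labels n (n + 1) (\<lambda>i x. F (shifted x) i)"

lemma shifted_cube_cong:
  assumes "\<And>v l. v 0 \<Longrightarrow> \<not> v (Suc n) \<Longrightarrow> l \<le> n + 1 \<Longrightarrow> F v l = H v l"
  shows "shifted_cube n F = shifted_cube n H"
  unfolding shifted_cube_def cube_of_labels_def
  by (rule restrict_ext) (use assms shifted_0 shifted_last in \<open>auto simp: points_def\<close>)

text \<open>Reduces a gluing to propositional identities in an arbitrary \<open>v\<close>, of which
  only the boundary values \<open>v 0\<close> and \<open>v (Suc n)\<close> are known.\<close>

lemma shifted_cube_glue: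
  assumes F: "shifted_cube n F \<in> generated_by_gluing n A"
    and H: "shifted_cube n H \<in> generated_by_gluing n A"
    and j: "j < n"
    and agree: "\<And>v l. v 0 \<Longrightarrow> \<not> v (Suc n) \<Longrightarrow> v (Suc j) = e \<Longrightarrow> l \<le> n + 1 \<Longrightarrow> F v l = H v l"
    and K: "\<And>v l. v 0 \<Longrightarrow> \<not> v (Suc n) \<Longrightarrow> l \<le> n + 1 \<Longrightarrow>
      K v l = (if v (Suc j) then F (v(Suc j := \<not> e)) l else H (v(Suc j := \<not> e)) l)"
  shows "shifted_cube n K \<in> generated_by_gluing n A"
proof -
  have "shifted_cube n F x = shifted_cube n H x" if "length x = n" "x ! j = e" for x
    using agree[OF shifted_0 shifted_last] that j shifted_nth
    by (auto simp: shifted_cube_def cube_of_labels_def points_def)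
  then have "agree_on_face n j e (shifted_cube n F) (shifted_cube n H)"
    unfolding agree_on_face_def face_def
    by (intro restrict_ext) (use j in \<open>simp add: points_def nth_append\<close>)
  then have "glue n j e (shifted_cube n F) (shifted_cube n H) \<in> generated_by_gluing n A"
    using F H j generated_by_gluing.glue by blast
  moreover have "shifted_cube n K = glue n j e (shifted_cube n F) (shifted_cube n H)"
  proof
    fix x
    show "shifted_cube n K x = glue n j e (shifted_cube n F) (shifted_cube n H) x"
      using K[of "shifted x", OF shifted_0 shifted_last] j
      by (auto simp: shifted_cube_def cube_of_labels_def glue_def points_def shifted_nth
          shifted_list_update)
  qed
  ultimately show ?thesis by simp
qed

definition omit_label :: "nat \<Rightarrow> nat \<Rightarrow> (nat \<Rightarrow> bool) \<Rightarrow> nat \<Rightarrow> bool" where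
  "omit_label m i v l \<longleftrightarrow>
    l = m \<or> (if l < i then edge_label v l else l \<noteq> i \<and> edge_label v (l - 1))"

definition split_label :: "nat \<Rightarrow> nat \<Rightarrow> (nat \<Rightarrow> bool) \<Rightarrow> nat \<Rightarrow> bool" where
  "split_label m k v l \<longleftrightarrow>
    l = m \<or> (if l < k then edge_label v l else if l = k then \<not> v k
             else if l = Suc k then v (Suc k) else edge_label v (l - 1))"

text \<open>\<open>delta i\<close> maps \<open>{0..n}\<close> onto the labels other than
  \<open>i\<close>, and at \<open>i\<close> itself \<open>F\<close> is false.\<close>

lemma relabel_cube_of_labels:
  assumes "i \<le> n + 1"
    and "\<And>x k. k \<le> n \<Longrightarrow> f k x = F (shifted x) (delta i k)"
    and "\<And>v. \<not> F v i"
  shows "relabel n (delta i) (cube_of_labels n n f) = shifted_cube n F"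
proof -
  have "delta i ` {k \<in> {0..n}. f k x} = {l \<in> {0..n + 1}. F (shifted x) l}" for x
  proof (intro set_eqI iffI)
    fix l assume l: "l \<in> {l \<in> {0..n + 1}. F (shifted x) l}"
    with assms(3) have "l \<noteq> i" by auto
    define k where "k = (if l < i then l else l - 1)"
    have "l = delta i k" "k \<le> n"
      using l assms(1) \<open>l \<noteq> i\<close> by (auto simp: k_def delta_def)
    with l assms(2) show "l \<in> delta i ` {k \<in> {0..n}. f k x}" by auto
  qed (use assms(1,2) in \<open>auto simp: delta_def split: if_splits\<close>)
  then show ?thesis
    unfolding relabel_def cube_of_labels_def shifted_cube_def
    by (intro restrict_ext) simp
qed

text \<open>Here \<open>n + 2\<close> lies outside the labels, so no label function is made constant.\<close>
lemma C_relabelled_eq: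
  "i \<le> n + 1 \<Longrightarrow> C_relabelled n i = shifted_cube n (omit_label (n + 2) i)"
  unfolding C_relabelled_def C_cube_def
  by (rule relabel_cube_of_labels)
    (auto simp: omit_label_def edge_label_def delta_def shifted_def)

lemma D_relabelled_eq:
  "i \<le> n + 1 \<Longrightarrow> D_relabelled n i = shifted_cube n (omit_label (delta i n) i)"
  unfolding D_relabelled_def D_cube_def
  by (rule relabel_cube_of_labels)
    (auto simp: omit_label_def edge_label_def delta_def shifted_def)

text \<open>Only labels \<open>j\<close> and \<open>j + 1\<close> involve the inserted coordinate; a
  true \<open>e\<close> makes the former constant, a false one the latter.\<close>

lemma face_C_cube_eq:
  assumes "j \<le> n"
  shows "face n j e (C_cube (n + 1)) = shifted_cube n (split_label (if e then j else Suc j) j)"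
proof -
  have "(coord (take j x @ e # drop j x) (int l) \<or> \<not> coord (take j x @ e # drop j x) (int l - 1)) =
      split_label (if e then j else Suc j) j (shifted x) l"
    if x: "length x = n" and l: "l \<le> n + 1" for x l
  proof -
    define z where "z = take j x @ e # drop j x"
    have "(coord z (int l) \<or> \<not> coord z (int l - 1)) \<longleftrightarrow> shifted z (Suc l) \<or> \<not> shifted z l"
      by (simp add: shifted_def)
    also have "shifted z (Suc l) =
        (if Suc l \<le> j then shifted x (Suc l) else if l = j then e else shifted x l)"
      using shifted_insert[of j x "Suc l" e] x l assms by (simp add: z_def)
    also have "shifted z l =
        (if l \<le> j then shifted x l else if l = Suc j then e else shifted x (l - 1))"
      using shifted_insert[of j x l e] x l assms by (simp add: z_def)
    finally show ?thesis
      unfolding z_def by (cases l) (simp_all add: split_label_def edge_label_def)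
  qed
  then have "{l \<in> {0..n + 1}. coord (take j x @ e # drop j x) (int l) \<or>
        \<not> coord (take j x @ e # drop j x) (int l - 1)} =
      {l \<in> {0..n + 1}. split_label (if e then j else Suc j) j (shifted x) l}"
    if "length x = n" for x
    using that by (intro Collect_cong conj_cong refl) simp
  then show ?thesis
    unfolding face_def C_cube_def cube_of_labels_def shifted_cube_def
    using assms by (intro restrict_ext) (simp add: points_def)
qed

lemma omit_label_generated:
  assumes C: "shifted_cube n (omit_label (n + 2) i) \<in> generated_by_gluing n A"
    and D: "shifted_cube n (omit_label (delta i n) i) \<in> generated_by_gluing n A"
    and i: "i \<le> n + 1" and m: "m \<le> n + 1" "m \<noteq> i"
  shows "shifted_cube n (omit_label m i) \<in> generated_by_gluing n A"
proof -
  have "shifted_cube n (omit_label (delta i k) i) \<in> generated_by_gluing n A" if "k \<le> n" for k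
    using that
  proof (induction rule: inc_induct)
    case (step k)
    \<comment> \<open>Where \<open>x_k = 0\<close>, label \<open>delta i (Suc k)\<close> is already
      1, so the two cubes agree. Both halves are evaluated at \<open>x_k = 1\<close>, which makes
      label \<open>delta i k\<close> constant.\<close>
    show ?case
    proof (rule shifted_cube_glue[OF C step.IH, where j = k and e = False])
      fix v l assume "l \<le> n + 1" "v (Suc k) = False"
      then show "omit_label (n + 2) i v l = omit_label (delta i (Suc k)) i v l"
        by (cases "Suc k < i") (auto simp: omit_label_def edge_label_def delta_def)
    next
      fix v l assume l: "l \<le> n + 1"
      consider "Suc k < i" | "Suc k = i" | "i \<le> k" by linarith
      then show "omit_label (delta i k) i v l =
        (if v (Suc k) then omit_label (n + 2) i (v(Suc k := \<not> False)) l
         else omit_label (delta i (Suc k)) i (v(Suc k := \<not> False)) l)"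
        using l by cases (cases l; auto simp: omit_label_def edge_label_def delta_def)+
    qed (use step.hyps in simp)
  qed (rule D)
  moreover have "m = delta i (if m < i then m else m - 1)" "(if m < i then m else m - 1) \<le> n"
    using i m by (auto simp: delta_def)
  ultimately show ?thesis by metis
qed

lemma split_label_generated_down:
  assumes W: "\<And>i. i \<le> n + 1 \<Longrightarrow> m \<noteq> i \<Longrightarrow>
      shifted_cube n (omit_label m i) \<in> generated_by_gluing n A"
    and "m \<le> k" "k \<le> n"
  shows "shifted_cube n (split_label m k) \<in> generated_by_gluing n A"
  using assms(3,2)
proof (induction rule: inc_induct)
  case base
  \<comment> \<open>As \<open>v (n + 1)\<close> is false, \<open>edge_label v n\<close> is just
    \<open>\<not> v n\<close>, and label \<open>n + 1\<close> disappears.\<close>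
  have "shifted_cube n (split_label m n) = shifted_cube n (omit_label m (n + 1))"
    by (rule shifted_cube_cong)
      (auto simp: split_label_def omit_label_def edge_label_def less_Suc_eq)
  with W base show ?case by simp
next
  case (step k)
  have S: "shifted_cube n (split_label m (Suc k)) \<in> generated_by_gluing n A"
    and Z: "shifted_cube n (omit_label m (Suc k)) \<in> generated_by_gluing n A"
    using step W by auto
  \<comment> \<open>Both halves are evaluated at \<open>x_k = 0\<close>, where label
    \<open>k + 1\<close> is true in the first cube and false in the second; the gluing thus gives it
    \<open>x_k\<close>.\<close>
  show ?case
    by (rule shifted_cube_glue[OF S Z, where j = k and e = True])
      (use step.hyps \<open>m \<le> k\<close> in \<open>auto simp: omit_label_def split_label_def edge_label_def less_Suc_eq\<close>)
qed

lemma split_label_generated_up: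
  assumes W: "\<And>i. i \<le> n + 1 \<Longrightarrow> m \<noteq> i \<Longrightarrow>
      shifted_cube n (omit_label m i) \<in> generated_by_gluing n A"
    and "k < m" "k \<le> n"
  shows "shifted_cube n (split_label m k) \<in> generated_by_gluing n A"
  using assms(2,3)
proof (induction k)
  case 0
  \<comment> \<open>As \<open>v 0\<close> holds, label \<open>0\<close> disappears and
    \<open>edge_label v 0\<close> is just \<open>v 1\<close>.\<close>
  have "shifted_cube n (split_label m 0) = shifted_cube n (omit_label m 0)"
    by (rule shifted_cube_cong) (auto simp: split_label_def omit_label_def edge_label_def)
  with W 0 show ?case by simp
next
  case (Suc k)
  have S: "shifted_cube n (split_label m k) \<in> generated_by_gluing n A"
    and Z: "shifted_cube n (omit_label m (Suc k)) \<in> generated_by_gluing n A"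
    using Suc W by auto
  \<comment> \<open>Now both halves are evaluated at \<open>x_k = 1\<close>, where label
    \<open>k + 1\<close> is false in the first cube and true in the second, giving
    \<open>\<not> x_k\<close>.\<close>
  show ?case
    by (rule shifted_cube_glue[OF Z S, where j = k and e = False])
      (use Suc.prems in \<open>auto simp: omit_label_def split_label_def edge_label_def split: if_splits\<close>)
qed

theorem mainTheorem5:
  fixes n j :: nat and e :: bool
  assumes "n \<ge> 1" and "j \<le> n"
  shows "face n j e (C_cube (n + 1)) \<in>
    generated_by_gluing n ({C_relabelled n i |i. i \<le> n + 1} \<union> {D_relabelled n i |i. i \<le> n + 1})"
proof -
  let ?A = "{C_relabelled n i |i. i \<le> n + 1} \<union> {D_relabelled n i |i. i \<le> n + 1}"
  have "shifted_cube n (omit_label m i) \<in> generated_by_gluing n ?A"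
    if "i \<le> n + 1" "m \<le> n + 1" "m \<noteq> i" for m i
  proof (rule omit_label_generated[OF _ _ that])
    show "shifted_cube n (omit_label (n + 2) i) \<in> generated_by_gluing n ?A"
      using that(1) C_relabelled_eq[symmetric] by (intro generated_by_gluing.base) auto
    show "shifted_cube n (omit_label (delta i n) i) \<in> generated_by_gluing n ?A"
      using that(1) D_relabelled_eq[symmetric] by (intro generated_by_gluing.base) auto
  qed
  then have "shifted_cube n (split_label (if e then j else Suc j) j) \<in> generated_by_gluing n ?A"
    using assms(2) split_label_generated_down[of n j ?A j] split_label_generated_up[of n "Suc j" ?A j]
    by (cases e) simp_all
  then show ?thesis
    using face_C_cube_eq[OF assms(2)] by simp
qed

end
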